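(* Let $(P,\cdot,[-,-],\varepsilon,\alpha,\beta)$ be a BiHom-Poisson color algebra over $\mathbb{K}$ and let $R:P\to P$ be a Rota-Baxter operator of weight $\lambda\in\mathbb{K}$ on $P$. For $x,y\in P$ put $$x\ast y=R(x)\cdot y+x\cdot R(y)+\lambda\,x\cdot y,\qquad \{x,y\}=[R(x),y]+[x,R(y)]+\lambda[x,y].$$ Then $(P,\ast,\{-,-\},\varepsilon,\alpha,\beta)$ is a BiHom-Poisson color algebra. Moreover, $R$ is a morphism of BiHom-Poisson color algebras from $(P,\ast,\{-,-\},\varepsilon,\alpha,\beta)$ into $(P,\cdot,[-,-],\varepsilon,\alpha,\beta)$.
   Context: $\mathbb{K}$ is a field of characteristic different from 2 and $G$ is an abelian group (written additively). A skew-symmetric bicharacter on $G$ is a map $\varepsilon:G\times G\to\mathbb{K}^*$ with $\varepsilon(g,g')\varepsilon(g',g)=1$, $\varepsilon(g,g'+g'')=\varepsilon(g,g')\varepsilon(g,g'')$, $\varepsilon(g+g',g'')=\varepsilon(g,g'')\varepsilon(g',g'')$; $\varepsilon$ denotes such a bicharacter. For homogeneous $x,y$ of degrees $g,g'$ one writes $\varepsilon(x,y)=\varepsilon(g,g')$. A linear map is even if it preserves degrees; a bilinear map $\mu$ is even if $\mu(V_g,V_{g'})\subseteq V_{g+g'}$. A BiHom-Poisson color algebra $(P,\cdot,[-,-],\varepsilon,\alpha,\beta)$ is a $G$-graded $\mathbb{K}$-vector space $P$ with an even bilinear product $\cdot$, an even bilinear bracket $[-,-]$, and even linear maps $\alpha,\beta:P\to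 P$ such that $\alpha\beta=\beta\alpha$, $\alpha$ and $\beta$ are multiplicative for both the product and the bracket, and for all homogeneous $x,y,z$: - $\alpha(x)\cdot(y\cdot z)=(x\cdot y)\cdot\beta(z)$; - $[\beta(x),\alpha(y)]=-\varepsilon(x,y)[\beta(y),\alpha(x)]$; - $\oint_{x,y,z}\varepsilon(z,x)[\beta^2(x),[\beta(y),\alpha(z)]]=0$ (cyclic sum over $x,y,z$); - $[\alpha\beta(x),y\cdot z]=[\beta(x),y]\cdot\beta(z)+\varepsilon(x,y)\,\beta(y)\cdot[\alpha(x),z]$. A morphism of BiHom-Poisson color algebras is an even linear map preserving product and bracket and intertwining the structure maps $\alpha$ and $\beta$. A Rota-Baxter operator of weight $\lambda\in\mathbb{K}$ on $P$ is an even linear map $R:P\to P$ with $\alpha R=R\alpha$, $\beta R=R\beta$, $R(x)\cdot R(y)=R\big(R(x)\cdot y+x\cdot R(y)+\lambda x\cdot y\big)$ and $[R(x),R(y)]=R\big([R(x),y]+[x,R(y)]+\lambda[x,y]\big)$ for all homogeneous $x,y\in P$. *)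

theory Defs
  imports Complex_Main
begin

locale skew_symmetric_bicharacter =
  fixes \<epsilon> :: "'g::ab_group_add \<Rightarrow> 'g \<Rightarrow> 'k::field"
  assumes bichar_nonzero: "\<epsilon> a b \<noteq> 0"
    and bichar_skew: "\<epsilon> a b * \<epsilon> b a = 1"
    and bichar_add_right: "\<epsilon> a (b + c) = \<epsilon> a b * \<epsilon> a c"
    and bichar_add_left: "\<epsilon> (a + b) c = \<epsilon> a c * \<epsilon> b c"

text \<open>
  The underlying vector space is a whole type. A grading is a family \<open>V\<close> of subspaces of which
  the space is the internal direct sum: every vector is the sum of a unique finitely supported
  family of homogeneous components. Elements of \<open>V g\<close> are the homogeneous elements of degree
  \<open>g\<close>; zero belongs to every degree.
\<close>

locale graded_vector_space = vector_space scale
  for scale :: "'k::field \<Rightarrow> 'v::ab_group_add \<Rightarrow> 'v" +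
  fixes V :: "'g::ab_group_add \<Rightarrow> 'v set"
  assumes subspace_component: "subspace (V g)"
    and unique_decomposition:
      "\<exists>!f. (\<forall>g. f g \<in> V g) \<and> finite {g. f g \<noteq> 0} \<and> x = (\<Sum>g\<in>{g. f g \<noteq> 0}. f g)"

locale even_linear_map =
  src: graded_vector_space s V + tgt: graded_vector_space t W + Vector_Spaces.linear s t f
  for s :: "'k::field \<Rightarrow> 'v::ab_group_add \<Rightarrow> 'v" and V :: "'g::ab_group_add \<Rightarrow> 'v set"
    and t :: "'k \<Rightarrow> 'w::ab_group_add \<Rightarrow> 'w" and W :: "'g \<Rightarrow> 'w set"
    and f :: "'v \<Rightarrow> 'w" +
  assumes even: "x \<in> V g \<Longrightarrow> f x \<in> W g"

locale even_bilinear_map = graded_vector_space s V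
  for s :: "'k::field \<Rightarrow> 'v::ab_group_add \<Rightarrow> 'v" and V :: "'g::ab_group_add \<Rightarrow> 'v set" +
  fixes \<mu> :: "'v \<Rightarrow> 'v \<Rightarrow> 'v"
  assumes linear_right: "Vector_Spaces.linear s s (\<lambda>y. \<mu> x y)"
    and linear_left: "Vector_Spaces.linear s s (\<lambda>x. \<mu> x y)"
    and even_bilinear: "x \<in> V g \<Longrightarrow> y \<in> V h \<Longrightarrow> \<mu> x y \<in> V (g + h)"

locale bihom_poisson_color_algebra =
  skew_symmetric_bicharacter \<epsilon> +
  graded_vector_space scale V +
  product: even_bilinear_map scale V mul +
  bracket: even_bilinear_map scale V br +
  alpha: even_linear_map scale V scale V \<alpha> +
  beta: even_linear_map scale V scale V \<beta>
  for scale :: "'k::field \<Rightarrow> 'v::ab_group_add \<Rightarrow> 'v"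
    and V :: "'g::ab_group_add \<Rightarrow> 'v set"
    and mul :: "'v \<Rightarrow> 'v \<Rightarrow> 'v"  (infixl \<open>\<cdot>\<close> 70)
    and br :: "'v \<Rightarrow> 'v \<Rightarrow> 'v"  (\<open>\<lbrakk>_, _\<rbrakk>\<close>)
    and \<epsilon> :: "'g \<Rightarrow> 'g \<Rightarrow> 'k"
    and \<alpha> :: "'v \<Rightarrow> 'v" and \<beta> :: "'v \<Rightarrow> 'v" +
  assumes alpha_beta_commute: "\<alpha> (\<beta> x) = \<beta> (\<alpha> x)"
    and alpha_product: "\<alpha> (x \<cdot> y) = \<alpha> x \<cdot> \<alpha> y"
    and beta_product: "\<beta> (x \<cdot> y) = \<beta> x \<cdot> \<beta> y"
    and alpha_bracket: "\<alpha> \<lbrakk>x, y\<rbrakk> = \<lbrakk>\<alpha> x, \<alpha> y\<rbrakk>"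
    and beta_bracket: "\<beta> \<lbrakk>x, y\<rbrakk> = \<lbrakk>\<beta> x, \<beta> y\<rbrakk>"
    and bihom_associative:
      "x \<in> V a \<Longrightarrow> y \<in> V b \<Longrightarrow> z \<in> V c \<Longrightarrow> \<alpha> x \<cdot> (y \<cdot> z) = (x \<cdot> y) \<cdot> \<beta> z"
    and bihom_skew_symmetric:
      "x \<in> V a \<Longrightarrow> y \<in> V b \<Longrightarrow> \<lbrakk>\<beta> x, \<alpha> y\<rbrakk> = - scale (\<epsilon> a b) \<lbrakk>\<beta> y, \<alpha> x\<rbrakk>"
    and bihom_jacobi:
      "x \<in> V a \<Longrightarrow> y \<in> V b \<Longrightarrow> z \<in> V c \<Longrightarrow>
         scale (\<epsilon> c a) \<lbrakk>\<beta> (\<beta> x), \<lbrakk>\<beta> y, \<alpha> z\<rbrakk>\<rbrakk>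
       + scale (\<epsilon> a b) \<lbrakk>\<beta> (\<beta> y), \<lbrakk>\<beta> z, \<alpha> x\<rbrakk>\<rbrakk>
       + scale (\<epsilon> b c) \<lbrakk>\<beta> (\<beta> z), \<lbrakk>\<beta> x, \<alpha> y\<rbrakk>\<rbrakk> = 0"
    and bihom_leibniz:
      "x \<in> V a \<Longrightarrow> y \<in> V b \<Longrightarrow> z \<in> V c \<Longrightarrow>
         \<lbrakk>\<alpha> (\<beta> x), y \<cdot> z\<rbrakk> = \<lbrakk>\<beta> x, y\<rbrakk> \<cdot> \<beta> z + scale (\<epsilon> a b) (\<beta> y \<cdot> \<lbrakk>\<alpha> x, z\<rbrakk>)"

locale bihom_poisson_color_morphism =
  src: bihom_poisson_color_algebra s V mul br \<epsilon> \<alpha> \<beta> +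
  tgt: bihom_poisson_color_algebra s' V' mul' br' \<epsilon> \<alpha>' \<beta>' +
  even_linear_map s V s' V' f
  for s :: "'k::field \<Rightarrow> 'v::ab_group_add \<Rightarrow> 'v" and V :: "'g::ab_group_add \<Rightarrow> 'v set"
    and mul br \<alpha> \<beta>
    and s' :: "'k \<Rightarrow> 'w::ab_group_add \<Rightarrow> 'w" and V' :: "'g \<Rightarrow> 'w set"
    and mul' br' \<alpha>' \<beta>'
    and \<epsilon> :: "'g \<Rightarrow> 'g \<Rightarrow> 'k"
    and f :: "'v \<Rightarrow> 'w" +
  assumes preserves_product: "f (mul x y) = mul' (f x) (f y)"
    and preserves_bracket: "f (br x y) = br' (f x) (f y)"
    and intertwines_alpha: "f (\<alpha> x) = \<alpha>' (f x)"
    and intertwines_beta: "f (\<beta> x) = \<beta>' (f x)"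

locale rota_baxter_operator =
  bihom_poisson_color_algebra scale V mul br \<epsilon> \<alpha> \<beta> +
  R: even_linear_map scale V scale V R
  for scale :: "'k::field \<Rightarrow> 'v::ab_group_add \<Rightarrow> 'v"
    and V :: "'g::ab_group_add \<Rightarrow> 'v set"
    and mul :: "'v \<Rightarrow> 'v \<Rightarrow> 'v"  (infixl \<open>\<cdot>\<close> 70)
    and br :: "'v \<Rightarrow> 'v \<Rightarrow> 'v"  (\<open>\<lbrakk>_, _\<rbrakk>\<close>)
    and \<epsilon> :: "'g \<Rightarrow> 'g \<Rightarrow> 'k"
    and \<alpha> :: "'v \<Rightarrow> 'v" and \<beta> :: "'v \<Rightarrow> 'v"
    and wt :: 'k
    and R :: "'v \<Rightarrow> 'v" +
  assumes alpha_R: "\<alpha> (R x) = R (\<alpha> x)"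
    and beta_R: "\<beta> (R x) = R (\<beta> x)"
    and rota_baxter_product:
      "x \<in> V a \<Longrightarrow> y \<in> V b \<Longrightarrow> R x \<cdot> R y = R (R x \<cdot> y + x \<cdot> R y + scale wt (x \<cdot> y))"
    and rota_baxter_bracket:
      "x \<in> V a \<Longrightarrow> y \<in> V b \<Longrightarrow>
         \<lbrakk>R x, R y\<rbrakk> = R (\<lbrakk>R x, y\<rbrakk> + \<lbrakk>x, R y\<rbrakk> + scale wt \<lbrakk>x, y\<rbrakk>)"

end

theory Submission
  imports Defs
begin

text \<open>
  Write \<open>m\<^sub>R x y = m (R x) y + m x (R y) + \<lambda> m x y\<close> for the operation induced by a bilinear
  operation \<open>m\<close>. The Rota-Baxter identity says exactly that \<open>R\<close> carries \<open>m\<^sub>R\<close> to \<open>m\<close>. It is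
  assumed on homogeneous elements, and both of its sides are biadditive, so it holds on the
  whole space (\<open>biadditive_eqI\<close>); this is the claim that \<open>R\<close> is a morphism.

  The axioms for the induced operations follow from one computation. Composing two induced
  operations, as in \<open>m\<^sub>R x (n\<^sub>R y z)\<close>, produces a term in which \<open>R\<close> is applied to \<open>n\<^sub>R y z\<close>, and the
  Rota-Baxter identity turns it into \<open>n (R y) (R z)\<close>. What remains is a sum over the proper
  subsets of the three slots of the trilinear map \<open>T x y z = m x (n y z)\<close>: \<open>R\<close> is inserted into
  the slots of the subset, and the coefficient is \<open>\<lambda>\<close> to the number of untouched slots minus one
  (\<open>nested_right\<close>, \<open>nested_left\<close>). This sum, \<open>rb_sum\<close>, depends linearly on \<open>T\<close>, does not
  care in which order the slots are listed, and evaluates \<open>T\<close> only at elements of unchanged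
  degrees, because \<open>R\<close> is even. Since \<open>R\<close> commutes with \<open>\<alpha>\<close> and \<open>\<beta>\<close>, these maps can be
  absorbed into \<open>T\<close>. Each trilinear identity among compositions of the original operations
  (associativity, Jacobi, Leibniz) therefore passes to the induced ones. Skew-symmetry involves
  two slots only and is checked term by term.
\<close>

text \<open>
  Homogeneous elements generate the space additively, so identities between additive maps
  extend from them to all vectors. The Rota-Baxter identities are extended in this way.
\<close>

lemma (in graded_vector_space) additive_eqI:
  assumes f: "\<And>x y. f (x + y) = f x + (f y :: 'w::ab_group_add)"
    and g: "\<And>x y. g (x + y) = g x + g y"
    and eq: "\<And>a x. x \<in> V a \<Longrightarrow> f x = g x"
  shows "f x = g x"
proof -
  obtain h where h: "\<forall>a. h a \<in> V a" "x = (\<Sum>a\<in>{a. h a \<noteq> 0}. h a)"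
    using unique_decomposition[of x] by blast
  interpret f: Modules.additive f by unfold_locales (rule f)
  interpret g: Modules.additive g by unfold_locales (rule g)
  have "f (h a) = g (h a)" for a
    using eq h(1) by blast
  then show ?thesis
    by (subst (1 2) h(2)) (simp add: f.sum g.sum)
qed

lemma (in graded_vector_space) biadditive_eqI:
  assumes f: "\<And>x x' y. f (x + x') y = f x y + (f x' y :: 'w::ab_group_add)"
      "\<And>x y y'. f x (y + y') = f x y + f x y'"
    and g: "\<And>x x' y. g (x + x') y = g x y + g x' y"
      "\<And>x y y'. g x (y + y') = g x y + g x y'"
    and eq: "\<And>a b x y. x \<in> V a \<Longrightarrow> y \<in> V b \<Longrightarrow> f x y = g x y"
  shows "f x y = g x y"
proof -
  have "f x y = g x y" if "y \<in> V b" for b y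
    by (rule additive_eqI[of "\<lambda>x. f x y" "\<lambda>x. g x y"]) (fact f(1) g(1) eq[OF _ that])+
  then show ?thesis
    by (rule additive_eqI[of "f x" "g x", OF f(2) g(2)])
qed

context even_bilinear_map
begin

lemma bilinear_add: "\<mu> (x + x') y = \<mu> x y + \<mu> x' y" "\<mu> x (y + y') = \<mu> x y + \<mu> x y'"
  using linear_left linear_right by (simp_all add: Vector_Spaces.linear_iff)

lemma bilinear_scale: "\<mu> (s c x) y = s c (\<mu> x y)" "\<mu> x (s c y) = s c (\<mu> x y)"
  using linear_left linear_right by (simp_all add: Vector_Spaces.linear_iff)

end

definition rb_product ::
    "('k \<Rightarrow> 'v \<Rightarrow> 'v) \<Rightarrow> 'k \<Rightarrow> ('v \<Rightarrow> 'v) \<Rightarrow> ('v \<Rightarrow> 'v \<Rightarrow> 'v) \<Rightarrow> 'v \<Rightarrow> 'v \<Rightarrow> 'v::ab_group_add"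
  where "rb_product s c R m x y = m (R x) y + m x (R y) + s c (m x y)"

text \<open>
  The exponent of \<open>c\<close> in each term is the number of slots without \<open>R\<close>, minus one. The term with
  \<open>R\<close> in all three slots is absent, as \<open>m\<^sub>R\<close> has no term \<open>m (R x) (R y)\<close>.
\<close>

definition rb_sum ::
    "('k \<Rightarrow> 'v \<Rightarrow> 'v) \<Rightarrow> 'k \<Rightarrow> ('v \<Rightarrow> 'v) \<Rightarrow> ('v \<Rightarrow> 'v \<Rightarrow> 'v \<Rightarrow> 'v) \<Rightarrow> 'v \<Rightarrow> 'v \<Rightarrow> 'v \<Rightarrow> 'v::ab_group_add"
  where "rb_sum s c R T x y z =
    T (R x) (R y) z + T (R x) y (R z) + T x (R y) (R z)
    + s c (T (R x) y z + T x (R y) z + T x y (R z)) + s c (s c (T x y z))"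

text \<open>
  The color identities are stated for homogeneous arguments, with coefficients that depend on
  the degrees. They survive insertion of \<open>R\<close> because \<open>R\<close> preserves degrees.
\<close>

lemma rb_sum_cong_homogeneous:
  assumes "\<And>a x. x \<in> V a \<Longrightarrow> R x \<in> V a"
    and "x \<in> V a" "y \<in> V b" "z \<in> V d"
    and "\<And>x y z. x \<in> V a \<Longrightarrow> y \<in> V b \<Longrightarrow> z \<in> V d \<Longrightarrow> T x y z = T' x y z"
  shows "rb_sum s c R T x y z = rb_sum s c R T' x y z"
  by (simp add: rb_sum_def assms)

context vector_space
begin

lemma rb_sum_add:
  "rb_sum scale c R T x y z + rb_sum scale c R T' x y z =
   rb_sum scale c R (\<lambda>x y z. T x y z + T' x y z) x y z"
  by (simp add: rb_sum_def scale_right_distrib ac_simps)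

lemma rb_sum_scale:
  "scale d (rb_sum scale c R T x y z) = rb_sum scale c R (\<lambda>x y z. scale d (T x y z)) x y z"
  by (simp add: rb_sum_def scale_right_distrib mult.left_commute mult.commute)

lemma rb_sum_zero: "rb_sum scale c R (\<lambda>x y z. 0) x y z = 0"
  by (simp add: rb_sum_def)

end

text \<open>
  The inner operation meets \<open>R\<close> in just one term of the outer one. The Rota-Baxter identity for
  the inner operation replaces that term by the one with \<open>R\<close> in both inner slots; the others
  expand by bilinearity of the outer operation. For the Leibniz rule the two operations differ.
\<close>

lemma (in even_bilinear_map) nested_right:
  assumes "R (rb_product s c R n y z) = n (R y) (R z)"
  shows "rb_product s c R \<mu> x (rb_product s c R n y z) = rb_sum s c R (\<lambda>x y z. \<mu> x (n y z)) x y z"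
proof -
  have "rb_product s c R \<mu> x (rb_product s c R n y z) =
      \<mu> (R x) (rb_product s c R n y z) + \<mu> x (n (R y) (R z)) + s c (\<mu> x (rb_product s c R n y z))"
    using assms by (simp add: rb_product_def[of _ _ _ \<mu>])
  then show ?thesis
    by (simp add: rb_product_def rb_sum_def bilinear_add bilinear_scale scale_right_distrib ac_simps)
qed

lemma (in even_bilinear_map) nested_left:
  assumes "R (rb_product s c R n x y) = n (R x) (R y)"
  shows "rb_product s c R \<mu> (rb_product s c R n x y) z = rb_sum s c R (\<lambda>x y z. \<mu> (n x y) z) x y z"
proof -
  have "rb_product s c R \<mu> (rb_product s c R n x y) z =
      \<mu> (n (R x) (R y)) z + \<mu> (rb_product s c R n x y) (R z) + s c (\<mu> (rb_product s c R n x y) z)"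
    using assms by (simp add: rb_product_def[of _ _ _ \<mu>])
  then show ?thesis
    by (simp add: rb_product_def rb_sum_def bilinear_add bilinear_scale scale_right_distrib ac_simps)
qed

lemma even_bilinear_map_rb_product:
  assumes "even_bilinear_map s V m" and "even_linear_map s V s V R"
  shows "even_bilinear_map s V (rb_product s c R m)"
proof -
  interpret m: even_bilinear_map s V m by fact
  interpret R: even_linear_map s V s V R by fact
  note expand = rb_product_def m.bilinear_add m.bilinear_scale R.add R.scale
    m.scale_right_distrib m.scale_left_commute ac_simps
  show ?thesis
  proof
    fix x y and a b
    assume "x \<in> V a" "y \<in> V b"
    then show "rb_product s c R m x y \<in> V (a + b)"
      using m.subspace_component[of "a + b"]
      by (simp add: rb_product_def m.subspace_add m.subspace_scale m.even_bilinear R.even)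
  qed (simp_all add: expand)
qed

context rota_baxter_operator
begin

abbreviation star where "star \<equiv> rb_product scale wt R (\<cdot>)"
abbreviation curly where "curly \<equiv> rb_product scale wt R br"

sublocale star: even_bilinear_map scale V star
  by (intro even_bilinear_map_rb_product product.even_bilinear_map_axioms R.even_linear_map_axioms)

sublocale curly: even_bilinear_map scale V curly
  by (intro even_bilinear_map_rb_product bracket.even_bilinear_map_axioms R.even_linear_map_axioms)

text \<open>
  The Rota-Baxter identities without homogeneity; the inner occurrences of \<open>R (m\<^sub>R y z)\<close> are
  rewritten with them.
\<close>

lemma R_star: "R (star x y) = R x \<cdot> R y"
  by (rule biadditive_eqI[of "\<lambda>x y. R (star x y)" "\<lambda>x y. R x \<cdot> R y"])
    (simp_all add: star.bilinear_add product.bilinear_add R.add R.scale scale_right_distrib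
      rota_baxter_product rb_product_def)

lemma R_curly: "R (curly x y) = \<lbrakk>R x, R y\<rbrakk>"
  by (rule biadditive_eqI[of "\<lambda>x y. R (curly x y)" "\<lambda>x y. \<lbrakk>R x, R y\<rbrakk>"])
    (simp_all add: curly.bilinear_add bracket.bilinear_add R.add R.scale scale_right_distrib
      rota_baxter_bracket rb_product_def)

lemma induced_associative:
  assumes "x \<in> V a" "y \<in> V b" "z \<in> V c"
  shows "star (\<alpha> x) (star y z) = star (star x y) (\<beta> z)"
proof -
  have "star (\<alpha> x) (star y z) = rb_sum scale wt R (\<lambda>x y z. \<alpha> x \<cdot> (y \<cdot> z)) x y z"
    by (simp add: product.nested_right R_star rb_sum_def alpha_R)
  also have "\<dots> = rb_sum scale wt R (\<lambda>x y z. (x \<cdot> y) \<cdot> \<beta> z) x y z"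
    by (intro rb_sum_cong_homogeneous[OF R.even assms] bihom_associative)
  also have "\<dots> = star (star x y) (\<beta> z)"
    by (simp add: product.nested_left R_star rb_sum_def beta_R)
  finally show ?thesis .
qed

text \<open>
  Skew-symmetry of the bracket applied to \<open>R x, y\<close> and to \<open>x, R y\<close> interchanges the two mixed
  terms of the induced bracket, with the sign factor of \<open>x, y\<close> since \<open>R\<close> is even.
\<close>

lemma induced_skew_symmetric:
  assumes "x \<in> V a" "y \<in> V b"
  shows "curly (\<beta> x) (\<alpha> y) = - scale (\<epsilon> a b) (curly (\<beta> y) (\<alpha> x))"
proof -
  have skew: "\<lbrakk>\<beta> u, \<alpha> v\<rbrakk> = - scale (\<epsilon> a b) \<lbrakk>\<beta> v, \<alpha> u\<rbrakk>" if "u \<in> V a" "v \<in> V b" for u v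
    using bihom_skew_symmetric that .
  show ?thesis
    using skew[OF R.even[OF assms(1)] assms(2)] skew[OF assms(1) R.even[OF assms(2)]] skew[OF assms]
    by (simp add: rb_product_def alpha_R beta_R scale_right_distrib scale_left_commute)
qed

lemma induced_jacobi:
  assumes "x \<in> V a" "y \<in> V b" "z \<in> V c"
  shows "scale (\<epsilon> c a) (curly (\<beta> (\<beta> x)) (curly (\<beta> y) (\<alpha> z)))
       + scale (\<epsilon> a b) (curly (\<beta> (\<beta> y)) (curly (\<beta> z) (\<alpha> x)))
       + scale (\<epsilon> b c) (curly (\<beta> (\<beta> z)) (curly (\<beta> x) (\<alpha> y))) = 0"
proof -
  \<comment> \<open>The three cyclic summands come with three orders of the variables; they must be sums over
    the slots of one and the same triple before the Jacobi identity applies under the sum.\<close>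
  let ?T = "\<lambda>x y z. \<lbrakk>\<beta> (\<beta> x), \<lbrakk>\<beta> y, \<alpha> z\<rbrakk>\<rbrakk>"
  have nested: "curly (\<beta> (\<beta> x)) (curly (\<beta> y) (\<alpha> z)) = rb_sum scale wt R ?T x y z" for x y z
    by (simp add: bracket.nested_right R_curly rb_sum_def alpha_R beta_R)
  have rotate: "rb_sum scale wt R ?T y z x = rb_sum scale wt R (\<lambda>x y z. ?T y z x) x y z"
    "rb_sum scale wt R ?T z x y = rb_sum scale wt R (\<lambda>x y z. ?T z x y) x y z"
    by (simp_all add: rb_sum_def ac_simps)
  have "rb_sum scale wt R (\<lambda>x y z. scale (\<epsilon> c a) (?T x y z) + scale (\<epsilon> a b) (?T y z x)
      + scale (\<epsilon> b c) (?T z x y)) x y z = rb_sum scale wt R (\<lambda>x y z. 0) x y z"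
    by (intro rb_sum_cong_homogeneous[OF R.even assms] bihom_jacobi)
  then show ?thesis
    by (simp only: nested rotate rb_sum_scale rb_sum_add rb_sum_zero)
qed

lemma induced_leibniz:
  assumes "x \<in> V a" "y \<in> V b" "z \<in> V c"
  shows "curly (\<alpha> (\<beta> x)) (star y z) =
    star (curly (\<beta> x) y) (\<beta> z) + scale (\<epsilon> a b) (star (\<beta> y) (curly (\<alpha> x) z))"
proof -
  have 1: "curly (\<alpha> (\<beta> x)) (star y z) =
      rb_sum scale wt R (\<lambda>x y z. \<lbrakk>\<alpha> (\<beta> x), y \<cdot> z\<rbrakk>) x y z"
    by (simp add: bracket.nested_right R_star rb_sum_def alpha_R beta_R)
  have 2: "star (curly (\<beta> x) y) (\<beta> z) = rb_sum scale wt R (\<lambda>x y z. \<lbrakk>\<beta> x, y\<rbrakk> \<cdot> \<beta> z) x y z"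
    by (simp add: product.nested_left R_curly rb_sum_def beta_R)
  have 3: "star (\<beta> y) (curly (\<alpha> x) z) = rb_sum scale wt R (\<lambda>x y z. \<beta> y \<cdot> \<lbrakk>\<alpha> x, z\<rbrakk>) x y z"
    by (simp add: product.nested_right R_curly rb_sum_def alpha_R beta_R ac_simps)
  show ?thesis
    unfolding 1 2 3 rb_sum_scale rb_sum_add
    by (intro rb_sum_cong_homogeneous[OF R.even assms] bihom_leibniz)
qed

sublocale induced: bihom_poisson_color_algebra scale V star curly \<epsilon> \<alpha> \<beta>
proof
  show "\<alpha> (star x y) = star (\<alpha> x) (\<alpha> y)" "\<alpha> (curly x y) = curly (\<alpha> x) (\<alpha> y)" for x y
    by (simp_all add: rb_product_def alpha.add alpha.scale alpha_product alpha_bracket alpha_R)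
  show "\<beta> (star x y) = star (\<beta> x) (\<beta> y)" "\<beta> (curly x y) = curly (\<beta> x) (\<beta> y)" for x y
    by (simp_all add: rb_product_def beta.add beta.scale beta_product beta_bracket beta_R)
qed (fact alpha_beta_commute induced_associative induced_skew_symmetric induced_jacobi
    induced_leibniz)+

lemma R_morphism:
  "bihom_poisson_color_morphism scale V star curly \<alpha> \<beta> scale V (\<cdot>) br \<alpha> \<beta> \<epsilon> R"
  by unfold_locales (simp_all add: R_star R_curly alpha_R beta_R)

end

theorem theorem3p16:
  fixes scale :: "'k::field \<Rightarrow> 'v::ab_group_add \<Rightarrow> 'v"
    and V :: "'g::ab_group_add \<Rightarrow> 'v set"
    and mul br star curly :: "'v \<Rightarrow> 'v \<Rightarrow> 'v"
    and \<epsilon> :: "'g \<Rightarrow> 'g \<Rightarrow> 'k"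
    and \<alpha> \<beta> R :: "'v \<Rightarrow> 'v"
    and wt :: 'k
  assumes "CHAR('k) \<noteq> 2"
    and "bihom_poisson_color_algebra scale V mul br \<epsilon> \<alpha> \<beta>"
    and "rota_baxter_operator scale V mul br \<epsilon> \<alpha> \<beta> wt R"
    and "\<And>x y. star x y = mul (R x) y + mul x (R y) + scale wt (mul x y)"
    and "\<And>x y. curly x y = br (R x) y + br x (R y) + scale wt (br x y)"
  shows "bihom_poisson_color_algebra scale V star curly \<epsilon> \<alpha> \<beta>
    \<and> bihom_poisson_color_morphism scale V star curly \<alpha> \<beta> scale V mul br \<alpha> \<beta> \<epsilon> R"
proof -
  interpret rota_baxter_operator scale V mul br \<epsilon> \<alpha> \<beta> wt R by fact
  have "star = rb_product scale wt R mul" "curly = rb_product scale wt R br"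
    by (simp_all add: fun_eq_iff rb_product_def assms(4,5))
  then show ?thesis
    using induced.bihom_poisson_color_algebra_axioms R_morphism by simp
qed

end
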